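(* For any integer $n\geq 0$, there exists a (weight-preserving) bijection $\sigma$ between $\mathcal{G}_n^{\mathbf{uvu}}(a,b,b^2)$ and $\mathcal{S}_{n}(a,b)$.
   Context: A G-Motzkin path of length $n$ is a lattice path from $(0,0)$ to $(n,0)$ in the first quadrant (never going below the $x$-axis) consisting of up steps $\mathbf{u}=(1,1)$, down steps $\mathbf{d}=(1,-1)$, horizontal steps $\mathbf{h}=(1,0)$ and vertical steps $\mathbf{v}=(0,-1)$. It is $\mathbf{uvu}$-avoiding if it contains no three consecutive steps $\mathbf{u},\mathbf{v},\mathbf{u}$. Here $a,b$ are commuting indeterminates. An $(a,b,c)$-G-Motzkin path is a G-Motzkin path in which each $\mathbf{u}$-, $\mathbf{h}$-, $\mathbf{v}$-, $\mathbf{d}$-step has weight $1,a,b,c$ respectively. $\mathcal{G}_n^{\mathbf{uvu}}(a,b,b^2)$ is the set of all $\mathbf{uvu}$-avoiding $(a,b,b^2)$-G-Motzkin paths of length $n$. A Schröder path of length $2n$ is a lattice path from $(0,0)$ to $(2n,0)$ in the first quadrant (never going below the $x$-axis) consisting of steps $\mathbf{u}=(1,1)$, $\mathbf{d}=(1,-1)$ and $\mathbf{H}=(2,0)$. An $(a,b)$-Schröder path is a Schröder path in which each $\mathbf{u}$-, $\mathbf{H}$-, $\mathbf{d}$-step has weight $1,a,b$ respectively. $\mathcal{S}_n(a,b)$ is the set of all $(a,b)$-Schröder paths of length $2n$. The weight of a path is the product of the weights of its steps; a bijection is weight-preserving if every path and its image have the same weight. *)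

theory Defs
  imports "HOL-Library.Product_Plus" "HOL-Library.Sublist"
    "HOL-Computational_Algebra.Polynomial"
begin

text \<open>A lattice path starting at the origin is the list of its steps; \<open>vec\<close> sends a step to its
  displacement. A path lies in the first quadrant iff all its vertices do, since every
  step is a straight segment.\<close>

definition endpoint :: "('s \<Rightarrow> int \<times> int) \<Rightarrow> 's list \<Rightarrow> int \<times> int" where
  "endpoint vec p = sum_list (map vec p)"

definition in_first_quadrant :: "('s \<Rightarrow> int \<times> int) \<Rightarrow> 's list \<Rightarrow> bool" where
  "in_first_quadrant vec p \<longleftrightarrow>
     (\<forall>q. prefix q p \<longrightarrow> fst (endpoint vec q) \<ge> 0 \<and> snd (endpoint vec q) \<ge> 0)"

definition path_weight :: "('s \<Rightarrow> 'r::comm_semiring_1) \<Rightarrow> 's list \<Rightarrow> 'r" where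
  "path_weight w p = prod_list (map w p)"

datatype gm_step = GU | GD | GH | GV

fun gm_vec :: "gm_step \<Rightarrow> int \<times> int" where
  "gm_vec GU = (1, 1)"
| "gm_vec GD = (1, - 1)"
| "gm_vec GH = (1, 0)"
| "gm_vec GV = (0, - 1)"

text \<open>The weights \<open>a, b, c\<close> belong to the steps \<open>h, v, d\<close>, in this order.\<close>

fun gm_step_weight :: "'r::comm_semiring_1 \<Rightarrow> 'r \<Rightarrow> 'r \<Rightarrow> gm_step \<Rightarrow> 'r" where
  "gm_step_weight a b c GU = 1"
| "gm_step_weight a b c GH = a"
| "gm_step_weight a b c GV = b"
| "gm_step_weight a b c GD = c"

definition gm_weight :: "'r::comm_semiring_1 \<Rightarrow> 'r \<Rightarrow> 'r \<Rightarrow> gm_step list \<Rightarrow> 'r" where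
  "gm_weight a b c = path_weight (gm_step_weight a b c)"

definition gm_paths :: "nat \<Rightarrow> gm_step list set" where
  "gm_paths n = {p. in_first_quadrant gm_vec p \<and> endpoint gm_vec p = (int n, 0)}"

definition uvu_avoiding :: "gm_step list \<Rightarrow> bool" where
  "uvu_avoiding p \<longleftrightarrow> \<not> sublist [GU, GV, GU] p"

definition gm_paths_uvu :: "nat \<Rightarrow> gm_step list set" where
  "gm_paths_uvu n = {p \<in> gm_paths n. uvu_avoiding p}"

datatype schroeder_step = SU | SD | SH

fun schroeder_vec :: "schroeder_step \<Rightarrow> int \<times> int" where
  "schroeder_vec SU = (1, 1)"
| "schroeder_vec SD = (1, - 1)"
| "schroeder_vec SH = (2, 0)"

fun schroeder_step_weight :: "'r::comm_semiring_1 \<Rightarrow> 'r \<Rightarrow> schroeder_step \<Rightarrow> 'r" where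
  "schroeder_step_weight a b SU = 1"
| "schroeder_step_weight a b SH = a"
| "schroeder_step_weight a b SD = b"

definition schroeder_weight :: "'r::comm_semiring_1 \<Rightarrow> 'r \<Rightarrow> schroeder_step list \<Rightarrow> 'r" where
  "schroeder_weight a b = path_weight (schroeder_step_weight a b)"

text \<open>The index \<open>n\<close> is half the length of the path.\<close>

definition schroeder_paths :: "nat \<Rightarrow> schroeder_step list set" where
  "schroeder_paths n =
     {p. in_first_quadrant schroeder_vec p \<and> endpoint schroeder_vec p = (2 * int n, 0)}"

text \<open>The two commuting indeterminates, as elements of the polynomial ring \<open>\<int>[a][b]\<close>
  (inner variable \<open>a\<close>, outer variable \<open>b\<close>). Equality of weights is thus equality of
  monomials in \<open>a\<close> and \<open>b\<close>, and specializes to every commutative ring.\<close>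

definition indet_a :: "int poly poly" where
  "indet_a = [:[:0, 1:]:]"

definition indet_b :: "int poly poly" where
  "indet_b = [:0, 1:]"

end

theory Submission
  imports Defs
begin

text \<open>
  Both families decompose at the first return to the axis. A Schroeder path is empty, \<open>H B\<close> or
  \<open>u A d B\<close>. A G-Motzkin path is empty, \<open>h Q\<close>, \<open>u P d Q\<close> or \<open>u P v Q\<close>, and a factor uvu arises
  only when some arch \<open>u P v Q\<close> has \<open>P\<close> empty and \<open>Q\<close> beginning with \<open>u\<close>. Turning \<open>v\<close> into \<open>d\<close>
  would thus give all Schroeder paths except those containing an empty arch followed by another arch,
  \<open>u d u A d B\<close>. Apart from \<open>A\<close> and \<open>B\<close>, such a path has weight \<open>b\<^sup>2\<close> and half-length 2, which are the
  weight and the length of the steps \<open>u\<close> and \<open>d\<close> of an arch \<open>u P d Q\<close>, the remaining case.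
  The bijection is therefore

    \<open>\<epsilon> \<mapsto> \<epsilon>\<close>, \<open>h Q \<mapsto> H \<sigma>(Q)\<close>, \<open>u P v Q \<mapsto> u \<sigma>(P) d \<sigma>(Q)\<close>, \<open>u P d Q \<mapsto> u d u \<sigma>(P) d \<sigma>(Q)\<close>:

  it preserves whether a path is empty and whether it begins with \<open>u\<close>, so the last two clauses
  have complementary ranges among the Schroeder paths beginning with \<open>u\<close>.

  To make this recursion available, paths are represented by trees recording the iterated
  first-return decomposition. That every path has exactly one such tree is
  \<open>bij_betw_tree_word\<close>, a fact about steps that change the height by at most one;
  \<open>uvu_avoiding_tree_word\<close> reads the pattern condition off the tree, and
  \<open>bij_betw_to_schroeder\<close> is the bijection on trees.
\<close>

section \<open>First-return decomposition\<close>

datatype 's arch_tree =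
    Empty
  | Flat 's "'s arch_tree"
  | is_Arch: Arch 's "'s arch_tree" 's "'s arch_tree"

fun tree_word :: "'s arch_tree \<Rightarrow> 's list" where
  "tree_word Empty = []"
| "tree_word (Flat s t) = s # tree_word t"
| "tree_word (Arch u t d t') = u # tree_word t @ d # tree_word t'"

text \<open>The function \<open>h\<close> gives the change of height along a step.\<close>

fun labelled :: "('s \<Rightarrow> int) \<Rightarrow> 's arch_tree \<Rightarrow> bool" where
  "labelled h Empty \<longleftrightarrow> True"
| "labelled h (Flat s t) \<longleftrightarrow> h s = 0 \<and> labelled h t"
| "labelled h (Arch u t d t') \<longleftrightarrow> h u = 1 \<and> labelled h t \<and> h d = -1 \<and> labelled h t'"

definition height :: "('s \<Rightarrow> int) \<Rightarrow> 's list \<Rightarrow> int" where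
  "height h p = sum_list (map h p)"

lemma height_simps [simp]:
  "height h [] = 0"
  "height h (s # p) = h s + height h p"
  "height h (p @ q) = height h p + height h q"
  by (simp_all add: height_def)

definition excursion :: "('s \<Rightarrow> int) \<Rightarrow> 's list \<Rightarrow> bool" where
  "excursion h p \<longleftrightarrow> (\<forall>q. prefix q p \<longrightarrow> height h q \<ge> 0) \<and> height h p = 0"

text \<open>The possible continuations after a complete return to the current level: the path stops or
  leaves that level downwards. This is the generality in which the inductions go through, since
  the inner part of an arch is followed by its closing step.\<close>

definition stops_or_descends :: "('s \<Rightarrow> int) \<Rightarrow> 's list \<Rightarrow> bool" where
  "stops_or_descends h r \<longleftrightarrow> r = [] \<or> h (hd r) = -1"

lemma stops_or_descends_simps [simp]:
  "stops_or_descends h []"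
  "stops_or_descends h (s # r) \<longleftrightarrow> h s = -1"
  by (simp_all add: stops_or_descends_def)

lemma height_tree_word: "labelled h t \<Longrightarrow> height h (tree_word t) = 0"
  by (induction t) auto

lemma height_prefix_tree_word:
  "labelled h t \<Longrightarrow> prefix q (tree_word t) \<Longrightarrow> height h q \<ge> 0"
proof (induction t arbitrary: q)
  case Empty
  then show ?case by simp
next
  case (Flat s t)
  then show ?case by (cases q) auto
next
  case (Arch u t d t')
  show ?case
  proof (cases q)
    case (Cons s q')
    then have "s = u" "prefix q' (tree_word t @ d # tree_word t')"
      using Arch.prems(2) by auto
    then consider "prefix q' (tree_word t)"
      | r where "q' = tree_word t @ r" "prefix r (d # tree_word t')"
      unfolding prefix_append by blast
    then show ?thesis
    proof cases
      case 1
      then have "height h q' \<ge> 0" using Arch by simp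
      then show ?thesis using Cons \<open>s = u\<close> Arch.prems by simp
    next
      case 2
      have "height h r \<ge> -1"
      proof (cases r)
        case r: (Cons _ r')
        then have "height h r' \<ge> 0"
          using 2(2) Arch.prems(1) by (intro Arch.IH(2)) auto
        then show ?thesis
          using r 2(2) Arch.prems(1) by simp
      qed simp
      then show ?thesis
        using 2(1) Cons \<open>s = u\<close> Arch.prems(1) by (simp add: height_tree_word)
    qed
  qed simp
qed

lemma excursion_tree_word: "labelled h t \<Longrightarrow> excursion h (tree_word t)"
  by (simp add: excursion_def height_tree_word height_prefix_tree_word)

text \<open>The word determines the tree because the first step determines the constructor, and the
  step closing an arch is the first one that goes below the level of the arch's interior.\<close>

lemma tree_word_append_inject:
  assumes "labelled h t" "labelled h t'" "stops_or_descends h r" "stops_or_descends h r'"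
    and "tree_word t @ r = tree_word t' @ r'"
  shows "t = t' \<and> r = r'"
  using assms
proof (induction t arbitrary: t' r r')
  case Empty
  then show ?case by (cases t') auto
next
  case (Flat s t)
  then show ?case by (cases t') auto
next
  case (Arch u t1 d t2)
  show ?case
  proof (cases t')
    case t': (Arch u' t1' d' t2')
    have "t1 = t1' \<and> d # tree_word t2 @ r = d' # tree_word t2' @ r'"
      using Arch.prems t' by (intro Arch.IH(1)) auto
    moreover from this have "t2 = t2' \<and> r = r'"
      using Arch.prems t' by (intro Arch.IH(2)) auto
    ultimately show ?thesis
      using Arch.prems t' by auto
  qed (use Arch.prems in auto)
qed

text \<open>Greedy parsing. The bound on the suffixes says that every step up is undone later, hence
  that each arch that is opened gets closed.\<close>

lemma parse_tree_word:
  assumes "range h \<subseteq> {-1, 0, 1}" and "\<And>q. suffix q p \<Longrightarrow> height h q \<le> 0"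
  shows "\<exists>t r. p = tree_word t @ r \<and> labelled h t \<and> stops_or_descends h r"
  using assms(2)
proof (induction p rule: length_induct)
  case (1 p)
  show ?case
  proof (cases p)
    case Nil
    then have "p = tree_word Empty @ []" by simp
    then show ?thesis by (metis labelled.simps(1) stops_or_descends_simps(1))
  next
    case (Cons s p')
    have suffixes: "height h q \<le> 0" if "suffix q p'" for q
      using "1.prems" that Cons by (simp add: suffix_Cons)
    have "length p' < length p"
      using Cons by simp
    then obtain t r where t: "p' = tree_word t @ r" "labelled h t" "stops_or_descends h r"
      using "1.IH" suffixes by blast
    consider "h s = -1" | "h s = 0" | "h s = 1"
      using assms(1) by force
    then show ?thesis
    proof cases
      case 1
      then have "p = tree_word Empty @ p" "stops_or_descends h p"
        using Cons by simp_all
      then show ?thesis by (metis labelled.simps(1))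
    next
      case 2
      then have "p = tree_word (Flat s t) @ r" "labelled h (Flat s t)"
        using Cons t by simp_all
      then show ?thesis using t(3) by blast
    next
      case up: 3
      have "r \<noteq> []"
        using "1.prems"[of p] up t height_tree_word[OF t(2)] Cons by auto
      then obtain d r' where r: "r = d # r'" "h d = -1"
        using t(3) by (cases r) auto
      have "suffix r' p'"
        using t(1) r(1) by (simp add: suffix_append suffix_Cons)
      then have "height h q \<le> 0" if "suffix q r'" for q
        using suffixes that suffix_order.trans by blast
      moreover have "length r' < length p"
        using Cons t(1) r(1) by simp
      ultimately obtain t' r'' where
        t': "r' = tree_word t' @ r''" "labelled h t'" "stops_or_descends h r''"
        using "1.IH" by blast
      then have "p = tree_word (Arch s t d t') @ r''" "labelled h (Arch s t d t')"
        using Cons t r up by simp_all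
      then show ?thesis using t'(3) by blast
    qed
  qed
qed

lemma excursion_imp_tree_word:
  assumes "range h \<subseteq> {-1, 0, 1}" and "excursion h p"
  shows "\<exists>t. labelled h t \<and> p = tree_word t"
proof -
  have "height h q \<le> 0" if "suffix q p" for q
  proof -
    from that obtain q' where q': "p = q' @ q" by (auto simp: suffix_def)
    then have "height h q' \<ge> 0" "height h q' + height h q = 0"
      using assms(2) unfolding excursion_def by auto
    then show ?thesis by simp
  qed
  then obtain t r where t: "p = tree_word t @ r" "labelled h t" "stops_or_descends h r"
    using parse_tree_word[OF assms(1)] by blast
  have "r = []"
  proof (cases r)
    case (Cons d r')
    \<comment> \<open>the path would dip below the axis just after the part described by \<open>t\<close>\<close>
    have "prefix (tree_word t @ [d]) p"
      using t(1) Cons by simp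
    then have "height h (tree_word t @ [d]) \<ge> 0"
      using assms(2) unfolding excursion_def by blast
    then show ?thesis
      using t Cons by (simp add: height_tree_word)
  qed
  then show ?thesis using t by auto
qed

lemma bij_betw_tree_word:
  assumes "range h \<subseteq> {-1, 0, 1}"
  shows "bij_betw tree_word {t. labelled h t} {p. excursion h p}"
  unfolding bij_betw_def
proof
  show "inj_on tree_word {t. labelled h t}"
    by (rule inj_onI)
       (use tree_word_append_inject[of h _ _ "[]" "[]"] in auto)
  show "tree_word ` {t. labelled h t} = {p. excursion h p}"
    using excursion_tree_word excursion_imp_tree_word[OF assms] by blast
qed

lemma bij_betw_tree_word_restrict:
  assumes "range h \<subseteq> {-1, 0, 1}"
  shows "bij_betw tree_word {t. labelled h t \<and> P (tree_word t)} {p. excursion h p \<and> P p}"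
proof (rule bij_betw_subset[OF bij_betw_tree_word[OF assms]])
  have surj: "tree_word ` {t. labelled h t} = {p. excursion h p}"
    by (rule bij_betw_imp_surj_on[OF bij_betw_tree_word[OF assms]])
  show "tree_word ` {t. labelled h t \<and> P (tree_word t)} = {p. excursion h p \<and> P p}"
  proof (intro equalityI subsetI)
    fix p assume "p \<in> {p. excursion h p \<and> P p}"
    moreover from this obtain t where "labelled h t" "p = tree_word t"
      using surj by blast
    ultimately show "p \<in> tree_word ` {t. labelled h t \<and> P (tree_word t)}" by blast
  qed (auto simp: excursion_tree_word)
qed blast

section \<open>G-Motzkin and Schroeder paths as excursions\<close>

lemma fst_sum_list: "fst (sum_list xs) = sum_list (map fst xs)"
  by (induction xs) auto

lemma snd_sum_list: "snd (sum_list xs) = sum_list (map snd xs)"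
  by (induction xs) auto

lemma snd_endpoint: "snd (endpoint vec p) = height (snd \<circ> vec) p"
  by (simp add: endpoint_def height_def snd_sum_list)

lemma fst_endpoint: "fst (endpoint vec p) = sum_list (map (fst \<circ> vec) p)"
  by (simp add: endpoint_def fst_sum_list)

lemma path_to_axis_iff_excursion:
  assumes "\<And>s. fst (vec s) \<ge> 0"
  shows "in_first_quadrant vec p \<and> endpoint vec p = (m, 0) \<longleftrightarrow>
    excursion (snd \<circ> vec) p \<and> fst (endpoint vec p) = m"
proof -
  have "fst (endpoint vec q) \<ge> 0" for q
    unfolding fst_endpoint by (rule sum_list_nonneg) (use assms in auto)
  then show ?thesis
    unfolding in_first_quadrant_def excursion_def
    by (auto simp: prod_eq_iff snd_endpoint)
qed

lemma gm_paths_iff: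
  "p \<in> gm_paths n \<longleftrightarrow> excursion (snd \<circ> gm_vec) p \<and> fst (endpoint gm_vec p) = int n"
proof -
  have "fst (gm_vec s) \<ge> 0" for s by (cases s) auto
  from path_to_axis_iff_excursion[OF this] show ?thesis
    by (simp add: gm_paths_def)
qed

lemma schroeder_paths_iff:
  "p \<in> schroeder_paths n \<longleftrightarrow>
     excursion (snd \<circ> schroeder_vec) p \<and> fst (endpoint schroeder_vec p) = 2 * int n"
proof -
  have "fst (schroeder_vec s) \<ge> 0" for s by (cases s) auto
  from path_to_axis_iff_excursion[OF this] show ?thesis
    by (simp add: schroeder_paths_def)
qed

lemma snd_gm_vec_iff [simp]:
  "snd (gm_vec s) = 1 \<longleftrightarrow> s = GU"
  "snd (gm_vec s) = 0 \<longleftrightarrow> s = GH"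
  "snd (gm_vec s) = -1 \<longleftrightarrow> s = GV \<or> s = GD"
  by (cases s; simp)+

lemma snd_schroeder_vec_iff [simp]:
  "snd (schroeder_vec s) = 1 \<longleftrightarrow> s = SU"
  "snd (schroeder_vec s) = 0 \<longleftrightarrow> s = SH"
  "snd (schroeder_vec s) = -1 \<longleftrightarrow> s = SD"
  by (cases s; simp)+

lemma range_snd_gm_vec: "range (snd \<circ> gm_vec) \<subseteq> {-1, 0, 1}"
proof -
  have "(snd \<circ> gm_vec) s \<in> {-1, 0, 1}" for s by (cases s) simp_all
  then show ?thesis by blast
qed

lemma range_snd_schroeder_vec: "range (snd \<circ> schroeder_vec) \<subseteq> {-1, 0, 1}"
proof -
  have "(snd \<circ> schroeder_vec) s \<in> {-1, 0, 1}" for s by (cases s) simp_all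
  then show ?thesis by blast
qed

section \<open>The pattern uvu on trees\<close>

fun uvu_free :: "gm_step arch_tree \<Rightarrow> bool" where
  "uvu_free Empty \<longleftrightarrow> True"
| "uvu_free (Flat s t) \<longleftrightarrow> uvu_free t"
| "uvu_free (Arch u t d t') \<longleftrightarrow>
     uvu_free t \<and> uvu_free t' \<and> \<not> (t = Empty \<and> d = GV \<and> is_Arch t')"

lemma uvu_avoiding_Cons:
  "uvu_avoiding (s # p) \<longleftrightarrow> \<not> prefix [GU, GV, GU] (s # p) \<and> uvu_avoiding p"
  by (auto simp: uvu_avoiding_def sublist_Cons_right)

text \<open>In a factor uvu the step \<open>v\<close> closes the arch opened by the \<open>u\<close> before it, so an occurrence of
  the pattern starts at an arch with empty interior.\<close>

lemma prefix_uvu_Arch: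
  assumes "labelled (snd \<circ> gm_vec) (Arch u t d t')" "stops_or_descends (snd \<circ> gm_vec) r"
  shows "prefix [GU, GV, GU] (tree_word (Arch u t d t') @ r) \<longleftrightarrow>
    t = Empty \<and> d = GV \<and> is_Arch t'"
proof (cases t)
  case Empty
  show ?thesis
    using assms Empty by (cases t'; cases r) auto
qed (use assms in auto)

lemma uvu_avoiding_tree_word_append:
  assumes "labelled (snd \<circ> gm_vec) t" "stops_or_descends (snd \<circ> gm_vec) r"
  shows "uvu_avoiding (tree_word t @ r) \<longleftrightarrow> uvu_free t \<and> uvu_avoiding r"
  using assms
proof (induction t arbitrary: r)
  case (Arch u t d t')
  have inner: "uvu_avoiding (tree_word t @ d # tree_word t' @ r) \<longleftrightarrow>
      uvu_free t \<and> uvu_avoiding (d # tree_word t' @ r)"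
    using Arch.prems by (intro Arch.IH(1)) auto
  have "uvu_avoiding (d # tree_word t' @ r) \<longleftrightarrow> uvu_free t' \<and> uvu_avoiding r"
    using Arch.IH(2)[of r] Arch.prems by (auto simp: uvu_avoiding_Cons)
  then show ?case
    using inner prefix_uvu_Arch[OF Arch.prems] by (auto simp: uvu_avoiding_Cons)
qed (auto simp: uvu_avoiding_Cons)

lemma uvu_avoiding_tree_word:
  "labelled (snd \<circ> gm_vec) t \<Longrightarrow> uvu_avoiding (tree_word t) \<longleftrightarrow> uvu_free t"
  using uvu_avoiding_tree_word_append[of t "[]"] by (simp add: uvu_avoiding_def)

section \<open>The bijection on trees\<close>

fun to_schroeder :: "gm_step arch_tree \<Rightarrow> schroeder_step arch_tree" where
  "to_schroeder Empty = Empty"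
| "to_schroeder (Flat s t) = Flat SH (to_schroeder t)"
| "to_schroeder (Arch u t d t') =
     (if d = GV then Arch SU (to_schroeder t) SD (to_schroeder t')
      else Arch SU Empty SD (Arch SU (to_schroeder t) SD (to_schroeder t')))"

fun of_schroeder :: "schroeder_step arch_tree \<Rightarrow> gm_step arch_tree" where
  "of_schroeder Empty = Empty"
| "of_schroeder (Flat s t) = Flat GH (of_schroeder t)"
| "of_schroeder (Arch u Empty d (Arch u' t d' t')) =
     Arch GU (of_schroeder t) GD (of_schroeder t')"
| "of_schroeder (Arch u t d t') = Arch GU (of_schroeder t) GV (of_schroeder t')"

lemma labelled_to_schroeder: "labelled (snd \<circ> schroeder_vec) (to_schroeder t)"
  by (induction t) auto

lemma labelled_of_schroeder: "labelled (snd \<circ> gm_vec) (of_schroeder t)"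
  by (induction t rule: of_schroeder.induct) auto

lemma to_schroeder_shape [simp]:
  "to_schroeder t = Empty \<longleftrightarrow> t = Empty"
  "is_Arch (to_schroeder t) \<longleftrightarrow> is_Arch t"
  by (cases t; simp)+

lemma of_schroeder_shape [simp]:
  "of_schroeder t = Empty \<longleftrightarrow> t = Empty"
  "is_Arch (of_schroeder t) \<longleftrightarrow> is_Arch t"
  by (cases t rule: of_schroeder.cases; simp)+

lemma uvu_free_of_schroeder: "uvu_free (of_schroeder t)"
  by (induction t rule: of_schroeder.induct) auto

lemma of_schroeder_Arch:
  "\<not> (t = Empty \<and> is_Arch t') \<Longrightarrow>
    of_schroeder (Arch u t d t') = Arch GU (of_schroeder t) GV (of_schroeder t')"
  by (cases t; cases t') auto

lemma of_schroeder_to_schroeder: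
  "labelled (snd \<circ> gm_vec) t \<Longrightarrow> uvu_free t \<Longrightarrow> of_schroeder (to_schroeder t) = t"
  by (induction t) (auto simp: of_schroeder_Arch)

lemma to_schroeder_of_schroeder:
  "labelled (snd \<circ> schroeder_vec) t \<Longrightarrow> to_schroeder (of_schroeder t) = t"
  by (induction t rule: of_schroeder.induct) auto

text \<open>Replacing an arch closed by \<open>v\<close> trades length 1 for length 2, and one closed by \<open>d\<close> trades
  length 2 for the length 4 of two arches.\<close>

lemma fst_endpoint_to_schroeder:
  "labelled (snd \<circ> gm_vec) t \<Longrightarrow>
    fst (endpoint schroeder_vec (tree_word (to_schroeder t))) =
    2 * fst (endpoint gm_vec (tree_word t))"
  by (induction t) (auto simp: fst_endpoint)

lemma weight_to_schroeder:
  fixes a b :: "'r :: comm_semiring_1"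
  assumes "labelled (snd \<circ> gm_vec) t"
  shows "schroeder_weight a b (tree_word (to_schroeder t)) = gm_weight a b (b ^ 2) (tree_word t)"
  using assms
  by (induction t)
     (auto simp: schroeder_weight_def gm_weight_def path_weight_def power2_eq_square mult_ac)

lemma bij_betw_to_schroeder:
  "bij_betw to_schroeder
     {t. labelled (snd \<circ> gm_vec) t \<and>
       fst (endpoint gm_vec (tree_word t)) = int n \<and> uvu_avoiding (tree_word t)}
     {t. labelled (snd \<circ> schroeder_vec) t \<and>
       fst (endpoint schroeder_vec (tree_word t)) = 2 * int n}"
    (is "bij_betw _ ?G ?S")
proof (rule bij_betw_byWitness[where f' = of_schroeder])
  show "\<forall>t\<in>?G. of_schroeder (to_schroeder t) = t"
    by (auto simp: of_schroeder_to_schroeder uvu_avoiding_tree_word)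
  show "\<forall>t\<in>?S. to_schroeder (of_schroeder t) = t"
    by (simp add: to_schroeder_of_schroeder)
  show "to_schroeder ` ?G \<subseteq> ?S"
    by (auto simp: labelled_to_schroeder fst_endpoint_to_schroeder)
  show "of_schroeder ` ?S \<subseteq> ?G"
  proof clarify
    fix t
    assume t: "labelled (snd \<circ> schroeder_vec) t"
      "fst (endpoint schroeder_vec (tree_word t)) = 2 * int n"
    then have "2 * fst (endpoint gm_vec (tree_word (of_schroeder t))) = 2 * int n"
      using fst_endpoint_to_schroeder[OF labelled_of_schroeder, of t]
      by (simp add: to_schroeder_of_schroeder)
    then show "labelled (snd \<circ> gm_vec) (of_schroeder t) \<and>
        fst (endpoint gm_vec (tree_word (of_schroeder t))) = int n \<and>
        uvu_avoiding (tree_word (of_schroeder t))"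
      by (simp add: labelled_of_schroeder uvu_avoiding_tree_word uvu_free_of_schroeder)
  qed
qed

section \<open>The bijection on paths\<close>

theorem theorem2p2:
  fixes n :: nat
  shows "\<exists>\<sigma> :: gm_step list \<Rightarrow> schroeder_step list.
    bij_betw \<sigma> (gm_paths_uvu n) (schroeder_paths n) \<and>
    (\<forall>p \<in> gm_paths_uvu n.
       schroeder_weight indet_a indet_b (\<sigma> p) = gm_weight indet_a indet_b (indet_b ^ 2) p)"
proof -
  let ?G = "{t. labelled (snd \<circ> gm_vec) t \<and>
    fst (endpoint gm_vec (tree_word t)) = int n \<and> uvu_avoiding (tree_word t)}"
  let ?S = "{t. labelled (snd \<circ> schroeder_vec) t \<and>
    fst (endpoint schroeder_vec (tree_word t)) = 2 * int n}"
  from bij_betw_tree_word_restrict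
    [OF range_snd_gm_vec, of "\<lambda>p. fst (endpoint gm_vec p) = int n \<and> uvu_avoiding p"]
  have G: "bij_betw tree_word ?G (gm_paths_uvu n)"
    by (simp add: gm_paths_uvu_def gm_paths_iff)
  from bij_betw_tree_word_restrict
    [OF range_snd_schroeder_vec, of "\<lambda>p. fst (endpoint schroeder_vec p) = 2 * int n"]
  have S: "bij_betw tree_word ?S (schroeder_paths n)"
    by (simp flip: schroeder_paths_iff)
  define \<sigma> where "\<sigma> = tree_word \<circ> (to_schroeder \<circ> inv_into ?G tree_word)"
  have "bij_betw \<sigma> (gm_paths_uvu n) (schroeder_paths n)"
    unfolding \<sigma>_def
    by (intro bij_betw_trans[OF bij_betw_trans[OF bij_betw_inv_into[OF G] bij_betw_to_schroeder] S])
  moreover have "schroeder_weight indet_a indet_b (\<sigma> p) = gm_weight indet_a indet_b (indet_b ^ 2) p"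
    if p: "p \<in> gm_paths_uvu n" for p
  proof -
    define t where "t = inv_into ?G tree_word p"
    have "t \<in> ?G"
      using bij_betwE[OF bij_betw_inv_into[OF G]] p unfolding t_def by blast
    moreover have "tree_word t = p"
      using bij_betw_inv_into_right[OF G p] unfolding t_def .
    ultimately show ?thesis
      using weight_to_schroeder[of t indet_a indet_b] by (simp add: \<sigma>_def t_def)
  qed
  ultimately show ?thesis by blast
qed

end
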